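(* Let $g\in\mathbb{C}^N$. Then the collection $\{T_i g : 1\le i\le N\}$ is an orthonormal basis for $V(g)=\operatorname{span}\{T_i g:1\le i\le N\}$ if and only if $$|\widehat g(\lambda_l)|=\frac{1}{\sqrt N}\quad\text{for all } l\in\{1,\dots,N\}.$$ In this case $V(g)=\mathbb{C}^N$.
   Context: Let $G$ be an undirected, connected, weighted graph with vertex set $\mathcal V=\{1,\dots,N\}$, and let $A$ be an $N\times N$ diagonalizable matrix associated with $G$ (for example its adjacency matrix or its graph Laplacian), with eigenvalues $\lambda_1,\dots,\lambda_N$ (listed with multiplicity) and corresponding eigenvectors $\chi_1,\dots,\chi_N$ forming an orthonormal basis of $\mathbb{C}^N$. A signal $f:\mathcal V\to\mathbb{C}$ is identified with the vector $(f(1),\dots,f(N))\in\mathbb{C}^N$. The graph Fourier transform of $f\in\mathbb{C}^N$ is $\widehat f(\lambda_l)=\sum_{n=1}^N f(n)\overline{\chi_l(n)}$, $l=1,\dots,N$ (indexed by $l$). The generalized convolution is $(f\ast g)(n)=\sum_{l=1}^N \widehat f(\lambda_l)\widehat g(\lambda_l)\chi_l(n)$. For $i=1,\dots,N$, $\delta_i\in\mathbb{C}^N$ is given by $\delta_i(n)=1$ if $n=i$ and $0$ otherwise, and the generalized translation is $T_i f=\sqrt N\,(f\ast\delta_i)$. Collections such as $\{T_i g:1\le i\le N\}$ are regarded as families indexed by $i$ (so orthonormality means $\langle T_ig,T_jg\rangle=1$ if $i=j$ and $0$ if $i\neq j$). *)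

theory Defs
  imports "HOL-Analysis.Analysis"
begin

text \<open>
  The vertex set is a finite type \<open>'n\<close> with \<open>N = CARD('n)\<close>, and signals are vectors in
  \<open>complex ^ 'n\<close>. A weighted graph is given by its weight function: \<open>i\<close> and \<open>j\<close> are adjacent
  iff their weight is nonzero. Weights may be negative and loops are permitted, so the usual
  simple graphs with positive weights are included.
\<close>

definition undirected_graph :: "('n \<Rightarrow> 'n \<Rightarrow> real) \<Rightarrow> bool"
  where "undirected_graph w \<longleftrightarrow> (\<forall>i j. w i j = w j i)"

definition connected_graph :: "('n \<Rightarrow> 'n \<Rightarrow> real) \<Rightarrow> bool"
  where "connected_graph w \<longleftrightarrow> (\<forall>i j. (\<lambda>a b. w a b \<noteq> 0)\<^sup>*\<^sup>* i j)"

text \<open>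
  The library inner product on \<open>complex ^ 'n\<close> is the real part of this Hermitian one.
\<close>

definition cinner :: "complex ^ 'n \<Rightarrow> complex ^ 'n \<Rightarrow> complex"
  where "cinner x y = (\<Sum>n\<in>UNIV. x $ n * cnj (y $ n))"

definition orthonormal_family :: "('i \<Rightarrow> complex ^ 'n) \<Rightarrow> bool"
  where "orthonormal_family v \<longleftrightarrow> (\<forall>i j. cinner (v i) (v j) = (if i = j then 1 else 0))"

text \<open>
  \<open>vec.span\<close> is the span over the complex scalars (\<open>span\<close> would be the real one).
\<close>

definition orthonormal_basis_of :: "('i \<Rightarrow> complex ^ 'n) \<Rightarrow> (complex ^ 'n) set \<Rightarrow> bool"
  where "orthonormal_basis_of v V \<longleftrightarrow> orthonormal_family v \<and> vec.span (range v) = V"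

text \<open>
  An eigenbasis of \<open>A\<close>, indexed by \<open>'n\<close>; its existence makes \<open>A\<close> diagonalizable, and the
  family \<open>lam\<close> then lists the eigenvalues of \<open>A\<close> with multiplicity.
\<close>

definition orthonormal_eigenbasis ::
    "complex ^ 'n ^ 'n \<Rightarrow> ('n \<Rightarrow> complex) \<Rightarrow> ('n \<Rightarrow> complex ^ 'n) \<Rightarrow> bool"
  where "orthonormal_eigenbasis A lam chi \<longleftrightarrow>
    (\<forall>l. A *v chi l = lam l *s chi l) \<and> orthonormal_basis_of chi UNIV"

text \<open>
  The transform is indexed by \<open>l\<close> rather than by the value \<open>lam l\<close>, so repeated eigenvalues
  cause no ambiguity and only the eigenvectors enter the definitions below.
\<close>

definition graph_fourier :: "('n \<Rightarrow> complex ^ 'n) \<Rightarrow> complex ^ 'n \<Rightarrow> 'n \<Rightarrow> complex"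
  where "graph_fourier chi f l = (\<Sum>n\<in>UNIV. f $ n * cnj (chi l $ n))"

definition graph_convolution ::
    "('n \<Rightarrow> complex ^ 'n) \<Rightarrow> complex ^ 'n \<Rightarrow> complex ^ 'n \<Rightarrow> complex ^ 'n"
  where "graph_convolution chi f g =
    (\<chi> n. \<Sum>l\<in>UNIV. graph_fourier chi f l * graph_fourier chi g l * chi l $ n)"

definition graph_translation ::
    "('n \<Rightarrow> complex ^ 'n) \<Rightarrow> 'n \<Rightarrow> complex ^ 'n \<Rightarrow> complex ^ 'n"
  where "graph_translation chi i f =
    complex_of_real (sqrt (real CARD('n))) *s graph_convolution chi f (axis i 1)"

definition translation_space :: "('n \<Rightarrow> complex ^ 'n) \<Rightarrow> complex ^ 'n \<Rightarrow> (complex ^ 'n) set"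
  where "translation_space chi g = vec.span (range (\<lambda>i. graph_translation chi i g))"

end

theory Submission imports Defs begin

text \<open>
  By orthonormality of the eigenvectors, the coefficient of \<open>T\<^sub>i g\<close> along \<open>\<chi>\<^sub>l\<close> is
  \<open>\<surd>N \<cdot> \<^bold>g(l) \<cdot> cnj (\<chi>\<^sub>l(i))\<close>, where \<open>\<^bold>g\<close> is the Fourier transform of \<open>g\<close>. Hence the Gram matrix of the
  translates is \<open>U D U\<^sup>*\<close>, where the unitary \<open>U\<close> has entries \<open>cnj (\<chi>\<^sub>l(i))\<close> and \<open>D\<close> is diagonal
  with entries \<open>N \<bar>\<^bold>g(l)\<bar>\<^sup>2\<close>. It is the identity iff \<open>D\<close> is. In that case the \<open>N\<close> translates are
  orthonormal in an \<open>N\<close>-dimensional space, so they span it.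
\<close>

lemma cinner_sum_left: "cinner (\<Sum>l\<in>S. x l) y = (\<Sum>l\<in>S. cinner (x l) y)"
  unfolding cinner_def sum_component sum_distrib_right by (rule sum.swap)

lemma cinner_scale_left: "cinner (c *s x) y = c * cinner x y"
  by (simp add: cinner_def sum_distrib_left mult.assoc)

lemma cnj_cinner: "cnj (cinner x y) = cinner y x"
  by (simp add: cinner_def mult.commute)

lemma graph_fourier_eq_cinner: "graph_fourier chi f l = cinner f (chi l)"
  by (simp add: graph_fourier_def cinner_def)

text \<open>Orthonormality of the \<open>v l\<close> says that the square matrix with these rows has
  its conjugate transpose as right inverse. A one-sided inverse of a square matrix is two-sided, and
  the other product gives orthonormality of the columns.\<close>

lemma orthonormal_family_completeness:
  fixes v :: "'n::finite \<Rightarrow> complex ^ 'n"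
  assumes "orthonormal_family v"
  shows "(\<Sum>l\<in>UNIV. cnj (v l $ m) * v l $ n) = (if m = n then 1 else 0)"
proof -
  let ?P = "(\<chi> i j. v i $ j) :: complex ^ 'n ^ 'n"
  let ?Q = "(\<chi> i j. cnj (v j $ i)) :: complex ^ 'n ^ 'n"
  have "?P ** ?Q = mat 1"
    using assms
    by (simp add: orthonormal_family_def cinner_def matrix_matrix_mult_def mat_def vec_eq_iff)
  then have "?Q ** ?P = mat 1"
    by (simp add: matrix_left_right_inverse)
  then show ?thesis
    by (simp add: matrix_matrix_mult_def mat_def vec_eq_iff)
qed

lemma orthonormal_family_expansion:
  fixes v :: "'n::finite \<Rightarrow> complex ^ 'n"
  assumes "orthonormal_family v"
  shows "(\<Sum>l\<in>UNIV. cinner x (v l) *s v l) = x"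
proof (subst vec_eq_iff, rule allI)
  fix n
  have "(\<Sum>l\<in>UNIV. cinner x (v l) *s v l) $ n
      = (\<Sum>m\<in>UNIV. \<Sum>l\<in>UNIV. x $ m * (cnj (v l $ m) * v l $ n))"
    unfolding cinner_def sum_component vector_smult_component sum_distrib_right
    by (subst sum.swap) (simp add: mult.assoc)
  also have "\<dots> = (\<Sum>m\<in>UNIV. x $ m * (if m = n then 1 else 0))"
    by (simp only: sum_distrib_left [symmetric] orthonormal_family_completeness [OF assms])
  also have "\<dots> = x $ n"
    by (simp add: if_distrib [of "\<lambda>x. _ * x"] cong: if_cong)
  finally show "(\<Sum>l\<in>UNIV. cinner x (v l) *s v l) $ n = x $ n" .
qed

lemma span_orthonormal_family:
  fixes v :: "'n::finite \<Rightarrow> complex ^ 'n"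
  assumes "orthonormal_family v"
  shows "vec.span (range v) = UNIV"
proof -
  have "x \<in> vec.span (range v)" for x
  proof -
    have "(\<Sum>l\<in>UNIV. cinner x (v l) *s v l) \<in> vec.span (range v)"
      by (intro vec.span_sum vec.span_scale vec.span_base rangeI)
    then show ?thesis
      by (simp only: orthonormal_family_expansion [OF assms])
  qed
  then show ?thesis
    by blast
qed

text \<open>Expanding \<open>x\<close> alone suffices: the remaining factors
  \<open>cinner (v l) y\<close> are conjugate coefficients of \<open>y\<close> by Hermitian
  symmetry.\<close>

lemma parseval:
  fixes v :: "'n::finite \<Rightarrow> complex ^ 'n"
  assumes "orthonormal_family v"
  shows "cinner x y = (\<Sum>l\<in>UNIV. cinner x (v l) * cnj (cinner y (v l)))"
proof -
  have "cinner x y = cinner (\<Sum>l\<in>UNIV. cinner x (v l) *s v l) y"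
    by (simp only: orthonormal_family_expansion [OF assms])
  then show ?thesis
    by (simp add: cinner_sum_left cinner_scale_left cnj_cinner)
qed

lemma graph_fourier_axis: "graph_fourier chi (axis i 1) l = cnj (chi l $ i)"
  by (simp add: graph_fourier_def axis_def if_distrib [of "\<lambda>x. x * _"] cong: if_cong)

lemma graph_translation_expansion:
  fixes chi :: "'n::finite \<Rightarrow> complex ^ 'n"
  shows "graph_translation chi i g
    = (\<Sum>l\<in>UNIV. (complex_of_real (sqrt CARD('n)) * graph_fourier chi g l * cnj (chi l $ i)) *s chi l)"
  by (simp add: vec_eq_iff graph_translation_def graph_convolution_def graph_fourier_axis
      sum_distrib_left mult.assoc)

lemma graph_fourier_translation:
  fixes chi :: "'n::finite \<Rightarrow> complex ^ 'n"
  assumes "orthonormal_family chi"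
  shows "graph_fourier chi (graph_translation chi i g) l
    = complex_of_real (sqrt CARD('n)) * graph_fourier chi g l * cnj (chi l $ i)"
  using assms
  by (simp add: graph_translation_expansion graph_fourier_eq_cinner cinner_sum_left
      cinner_scale_left orthonormal_family_def if_distrib [of "\<lambda>x. _ * x"] cong: if_cong)

lemma cinner_graph_translation:
  fixes chi :: "'n::finite \<Rightarrow> complex ^ 'n"
  assumes "orthonormal_family chi"
  shows "cinner (graph_translation chi i g) (graph_translation chi j g)
    = (\<Sum>l\<in>UNIV. of_real (CARD('n) * (cmod (graph_fourier chi g l))\<^sup>2) * (cnj (chi l $ i) * chi l $ j))"
proof -
  \<comment> \<open>One Parseval summand, with \<open>a\<close> and \<open>b\<close> standing for
    the conjugated entries of \<open>chi l\<close> at \<open>i\<close> and \<open>j\<close>. The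
    second is conjugated twice, so \<open>cnj b\<close> becomes \<open>chi l $ j\<close>.\<close>
  have "(s * z * a) * cnj (s * z * b) = of_real (CARD('n) * (cmod z)\<^sup>2) * (a * cnj b)"
    if "s = complex_of_real (sqrt CARD('n))" for s z a b
  proof -
    have "s * cnj s = of_nat CARD('n)"
      by (simp add: that flip: of_real_mult)
    moreover have "z * cnj z = of_real ((cmod z)\<^sup>2)"
      by (rule complex_norm_square [symmetric])
    ultimately have "(s * cnj s) * (z * cnj z) * (a * cnj b)
        = of_real (CARD('n) * (cmod z)\<^sup>2) * (a * cnj b)"
      by simp
    then show ?thesis
      by (simp add: mult_ac)
  qed
  then show ?thesis
    unfolding parseval [OF assms, of "graph_translation chi i g"]
      graph_fourier_eq_cinner [symmetric] graph_fourier_translation [OF assms]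
    by (metis (no_types, lifting) complex_cnj_cnj sum.cong)
qed

text \<open>The sums are the entries of a matrix unitarily similar to the diagonal matrix of the
  \<open>c l\<close>, so it is the identity exactly when all its eigenvalues \<open>c l\<close> are
  1.\<close>

lemma diagonal_eq_one_iff:
  fixes v :: "'n::finite \<Rightarrow> complex ^ 'n" and c :: "'n \<Rightarrow> complex"
  assumes v: "orthonormal_family v"
  shows "(\<forall>i j. (\<Sum>l\<in>UNIV. c l * (cnj (v l $ i) * v l $ j)) = (if i = j then 1 else 0))
    \<longleftrightarrow> (\<forall>l. c l = 1)"
proof
  assume gram: "\<forall>i j. (\<Sum>l\<in>UNIV. c l * (cnj (v l $ i) * v l $ j)) = (if i = j then 1 else 0)"
  show "\<forall>m. c m = 1"
  proof
    fix m
    \<comment> \<open>The row vector \<open>v m\<close> is multiplied by the matrix: the identity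
      returns \<open>v m\<close>, while orthonormality leaves only the term \<open>l = m\<close>,
      scaled by \<open>c m\<close>.\<close>
    have eigen: "c m * v m $ j = v m $ j" for j
    proof -
      have "v m $ j = (\<Sum>i\<in>UNIV. v m $ i * (\<Sum>l\<in>UNIV. c l * (cnj (v l $ i) * v l $ j)))"
        by (simp add: gram if_distrib [of "\<lambda>x. _ * x"] cong: if_cong)
      also have "\<dots> = (\<Sum>l\<in>UNIV. c l * v l $ j * cinner (v m) (v l))"
        unfolding cinner_def sum_distrib_left by (subst sum.swap) (simp add: mult_ac)
      also have "\<dots> = c m * v m $ j"
        using v by (simp add: orthonormal_family_def if_distrib [of "\<lambda>x. _ * x"] cong: if_cong)
      finally show ?thesis ..
    qed
    \<comment> \<open>The unit norm allows \<open>v m\<close> to be cancelled from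
      \<open>c m *s v m = v m\<close>.\<close>
    have "cinner (v m) (v m) = 1"
      using v by (simp add: orthonormal_family_def)
    moreover have "c m *s v m = v m"
      by (simp add: vec_eq_iff eigen)
    ultimately show "c m = 1"
      by (metis cinner_scale_left mult.right_neutral)
  qed
next
  assume "\<forall>l. c l = 1"
  then show "\<forall>i j. (\<Sum>l\<in>UNIV. c l * (cnj (v l $ i) * v l $ j)) = (if i = j then 1 else 0)"
    by (simp add: orthonormal_family_completeness [OF v])
qed

lemma orthonormal_graph_translation_iff:
  fixes chi :: "'n::finite \<Rightarrow> complex ^ 'n"
  assumes "orthonormal_family chi"
  shows "orthonormal_family (\<lambda>i. graph_translation chi i g)
    \<longleftrightarrow> (\<forall>l. cmod (graph_fourier chi g l) = 1 / sqrt CARD('n))"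
proof -
  \<comment> \<open>Turns the condition that a diagonal entry is 1 into one on the modulus;
    \<open>r \<ge> 0\<close> excludes the negative root.\<close>
  have "complex_of_real (CARD('n) * r\<^sup>2) = 1 \<longleftrightarrow> r = 1 / sqrt CARD('n)" if "r \<ge> 0" for r :: real
  proof -
    have "complex_of_real (CARD('n) * r\<^sup>2) = 1 \<longleftrightarrow> CARD('n) * r\<^sup>2 = 1"
      by (simp only: of_real_eq_1_iff)
    also have "\<dots> \<longleftrightarrow> r\<^sup>2 = (1 / sqrt CARD('n))\<^sup>2"
      by (simp add: power_divide field_simps)
    also have "\<dots> \<longleftrightarrow> r = 1 / sqrt CARD('n)"
      using that by (intro power2_eq_iff_nonneg) auto
    finally show ?thesis .
  qed
  then show ?thesis
    unfolding orthonormal_family_def cinner_graph_translation [OF assms]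
      diagonal_eq_one_iff [OF assms]
    by simp
qed

theorem theorem3p2:
  fixes w :: "'n::finite \<Rightarrow> 'n \<Rightarrow> real"
    and A :: "complex ^ 'n ^ 'n"
    and lam :: "'n \<Rightarrow> complex"
    and chi :: "'n \<Rightarrow> complex ^ 'n"
    and g :: "complex ^ 'n"
  assumes "undirected_graph w" and "connected_graph w"
    and "orthonormal_eigenbasis A lam chi"
  shows "(orthonormal_basis_of (\<lambda>i. graph_translation chi i g) (translation_space chi g) \<longleftrightarrow>
           (\<forall>l. cmod (graph_fourier chi g l) = 1 / sqrt (real CARD('n)))) \<and>
         (orthonormal_basis_of (\<lambda>i. graph_translation chi i g) (translation_space chi g) \<longrightarrow>
           translation_space chi g = UNIV)"
proof -
  have chi: "orthonormal_family chi"
    using assms(3) by (simp add: orthonormal_eigenbasis_def orthonormal_basis_of_def)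
  \<comment> \<open>\<open>translation_space\<close> is by definition the span of the translates, so
    being a basis of it reduces to orthonormality; a family indexed by \<open>'n\<close> then spans
    the whole space.\<close>
  show ?thesis
    using orthonormal_graph_translation_iff [OF chi, of g] span_orthonormal_family
    by (auto simp: orthonormal_basis_of_def translation_space_def)
qed

end
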